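(* Let $\mathbb{X}$ be a vector lattice and $x_0\in\mathbb{X}$. Then the strong relation $\sim_{x_0}$ is an equivalence relation on $\mathbb{X}$.
   Context: A vector lattice (Riesz space) is a real ordered vector space in which the supremum of any pair of elements exists; $|x|=\sup\{x,-x\}$. For $x,y\ge 0$, $x\perp y$ means $|x-y|=x+y$; for arbitrary $x,y\in\mathbb{X}$, $x\perp y$ means $|x|\perp|y|$. For $x_0\in\mathbb{X}$ and $x,y\in\mathbb{X}$, we say $x$ is strongly related to $y$, written $x\sim_{x_0}y$, if $(x-y)\perp x_0$. *)

theory Defs
  imports Complex_Main "HOL-Library.Lattice_Algebras"
begin

(* Isabelle's \<open>lattice\<close> also carries \<open>inf\<close>. This costs no generality: in an ordered vector space
   with binary suprema, \<open>- sup (- x) (- y)\<close> is the infimum of x and y. The axiom \<open>abs_lattice\<close> of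
   \<open>lattice_ab_group_add_abs\<close> is \<bar>x\<bar> = sup x (- x). *)
class vector_lattice = ordered_real_vector + lattice_ab_group_add_abs

(* For x, y \<ge> 0, disjointness is \<bar>x - y\<bar> = x + y; arbitrary x, y are disjoint if \<bar>x\<bar> and \<bar>y\<bar> are.
   The lemma below shows that the two clauses agree on nonnegative elements. *)
definition vl_disjoint :: "'a::vector_lattice \<Rightarrow> 'a \<Rightarrow> bool" where
  "vl_disjoint x y \<longleftrightarrow> \<bar>\<bar>x\<bar> - \<bar>y\<bar>\<bar> = \<bar>x\<bar> + \<bar>y\<bar>"

lemma vl_disjoint_nonneg_iff:
  fixes x y :: "'a::vector_lattice"
  assumes "0 \<le> x" "0 \<le> y"
  shows "vl_disjoint x y \<longleftrightarrow> \<bar>x - y\<bar> = x + y"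
proof -
  have abs_eq: "\<bar>z\<bar> = z" if "0 \<le> z" for z :: 'a
  proof -
    have "- z \<le> z" using that by (meson neg_le_0_iff_le order_trans)
    then show ?thesis by (simp add: abs_lattice sup_absorb1)
  qed
  show ?thesis unfolding vl_disjoint_def using assms by (simp only: abs_eq)
qed

definition strongly_related :: "'a::vector_lattice \<Rightarrow> 'a \<Rightarrow> 'a \<Rightarrow> bool" where
  "strongly_related x0 x y \<longleftrightarrow> vl_disjoint (x - y) x0"

end

theory Submission
  imports Defs
begin

text \<open>Two nonnegative elements \<open>a\<close> and \<open>b\<close> satisfy \<open>\<bar>a - b\<bar> = a + b\<close> exactly when their meet
  vanishes, because \<open>\<bar>a - b\<bar>\<close> and \<open>a + b\<close> differ by \<open>inf (a + a) (b + b)\<close>,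
  which is zero if and only if \<open>inf a b\<close> is. Hence the elements
  disjoint from \<open>x0\<close> are those with \<open>inf \<bar>x\<bar> \<bar>x0\<bar> = 0\<close>. They form a subgroup: by the triangle
  inequality and the subadditivity of \<open>inf _ \<bar>x0\<bar>\<close> on nonnegative elements, sums of such elements
  are again of this kind (lemma \<open>vl_disjoint_add\<close>). The strong relation is congruence modulo this
  subgroup, and is therefore an equivalence relation.\<close>

text \<open>Translations distribute over meets, so the right-hand side is the meet of the four sums
  \<open>a + b\<close>, \<open>c + b\<close>, \<open>a + c\<close> and \<open>c + c\<close>; nonnegativity puts \<open>c\<close> below the last three.\<close>

lemma inf_add_le_add_inf:
  fixes a b c :: "'a::lattice_ab_group_add"
  assumes "0 \<le> a" "0 \<le> b" "0 \<le> c"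
  shows "inf (a + b) c \<le> inf a c + inf b c"
proof -
  have "inf a c + inf b c = inf (inf (a + b) (c + b)) (inf (a + c) (c + c))"
    by (simp add: add_inf_distrib_left add_inf_distrib_right)
  moreover have "c \<le> c + b" "c \<le> a + c" "c \<le> c + c"
    using assms by simp_all
  ultimately show ?thesis
    by (simp add: le_infI2)
qed

text \<open>Translating \<open>\<bar>a - b\<bar> = sup (a - b) (b - a)\<close> by \<open>- (a + b)\<close> gives
  \<open>sup (- (b + b)) (- (a + a))\<close>, which is minus a meet.\<close>

lemma abs_diff_eq_add_minus_inf:
  fixes a b :: "'a::lattice_ab_group_add_abs"
  shows "\<bar>a - b\<bar> = (a + b) - inf (a + a) (b + b)"
proof -
  have "(a + b) - inf (a + a) (b + b) = (a + b) + sup (- (a + a)) (- (b + b))"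
    by (simp only: diff_conv_add_uminus neg_inf_eq_sup)
  also have "\<dots> = sup (b - a) (a - b)"
    by (simp add: add_sup_distrib_left algebra_simps)
  also have "\<dots> = \<bar>a - b\<bar>"
    by (simp add: abs_lattice sup_commute)
  finally show ?thesis by simp
qed

lemma inf_double_eq_0_iff:
  fixes a b :: "'a::lattice_ab_group_add"
  assumes "0 \<le> a" "0 \<le> b"
  shows "inf (a + a) (b + b) = 0 \<longleftrightarrow> inf a b = 0"
proof
  assume "inf (a + a) (b + b) = 0"
  moreover have "inf a b \<le> inf (a + a) (b + b)"
    using assms by (intro inf_mono) simp_all
  ultimately show "inf a b = 0"
    using assms by (simp add: order_antisym)
next
  assume "inf a b = 0"
  \<comment> \<open>Subadditivity doubles one argument at a time.\<close>
  then have "inf (a + a) b \<le> 0"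
    using inf_add_le_add_inf[of a a b] assms by simp
  then have "inf b (a + a) = 0"
    using assms by (simp add: order_antisym inf_commute)
  then have "inf (b + b) (a + a) \<le> 0"
    using inf_add_le_add_inf[of b b "a + a"] assms by simp
  then show "inf (a + a) (b + b) = 0"
    using assms by (simp add: order_antisym inf_commute)
qed

lemma vl_disjoint_iff_inf_abs:
  fixes x y :: "'a::vector_lattice"
  shows "vl_disjoint x y \<longleftrightarrow> inf \<bar>x\<bar> \<bar>y\<bar> = 0"
proof -
  have "vl_disjoint x y \<longleftrightarrow> inf (\<bar>x\<bar> + \<bar>x\<bar>) (\<bar>y\<bar> + \<bar>y\<bar>) = 0"
    unfolding vl_disjoint_def abs_diff_eq_add_minus_inf
    by (metis diff_0_right diff_left_imp_eq)
  then show ?thesis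
    by (simp only: inf_double_eq_0_iff abs_ge_zero)
qed

lemma vl_disjoint_0_left: "vl_disjoint 0 (z :: 'a::vector_lattice)"
  by (simp add: vl_disjoint_iff_inf_abs inf_absorb1)

lemma vl_disjoint_minus_commute:
  fixes x y z :: "'a::vector_lattice"
  shows "vl_disjoint (x - y) z \<longleftrightarrow> vl_disjoint (y - x) z"
  by (simp add: vl_disjoint_iff_inf_abs abs_minus_commute)

lemma vl_disjoint_add:
  fixes x y z :: "'a::vector_lattice"
  assumes "vl_disjoint x z" "vl_disjoint y z"
  shows "vl_disjoint (x + y) z"
proof -
  have "inf \<bar>x + y\<bar> \<bar>z\<bar> \<le> inf (\<bar>x\<bar> + \<bar>y\<bar>) \<bar>z\<bar>"
    by (intro inf_mono abs_triangle_ineq order_refl)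
  also have "\<dots> \<le> inf \<bar>x\<bar> \<bar>z\<bar> + inf \<bar>y\<bar> \<bar>z\<bar>"
    by (intro inf_add_le_add_inf abs_ge_zero)
  also have "\<dots> = 0"
    using assms by (simp add: vl_disjoint_iff_inf_abs)
  finally show ?thesis
    by (simp add: vl_disjoint_iff_inf_abs order_antisym)
qed

theorem proposition3p3:
  fixes x0 :: "'a::vector_lattice"
  shows "equivp (strongly_related x0)"
proof (rule equivpI)
  show "reflp (strongly_related x0)"
    by (simp add: reflp_def strongly_related_def vl_disjoint_0_left)
  show "symp (strongly_related x0)"
    using vl_disjoint_minus_commute by (auto simp: symp_def strongly_related_def)
  show "transp (strongly_related x0)"
  proof (rule transpI)
    fix x y z
    assume "strongly_related x0 x y" "strongly_related x0 y z"
    then show "strongly_related x0 x z"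
      using vl_disjoint_add[of "x - y" x0 "y - z"] by (simp add: strongly_related_def)
  qed
qed

end
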